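(* Let $\epsilon=(\epsilon^{(1)},\ldots,\epsilon^{(n)})^T$ be a random vector in $\mathbb{R}^n$ with finite mean whose distribution is absolutely continuous with respect to the Lebesgue measure and fully supported on $\mathbb{R}^n$. Let $E:\mathbb{R}^n\to\mathbb{R}$ be its surplus function and $E^*:\mathbb{R}^n\to\mathbb{R}\cup\{\infty\}$ the convex conjugate of $E$. Then the domain $\mathrm{dom}\,E^*=\{p\in\mathbb{R}^n \mid E^*(p)<\infty\}$ coincides with the simplex $\Delta$, and $E^*$ is continuous on its domain $\mathrm{dom}\,E^*=\Delta$.
   Context: Vectors $x\in\mathbb{R}^n$ have components $x^{(1)},\ldots,x^{(n)}$ and $\langle x,y\rangle=\sum_{i=1}^n x^{(i)}y^{(i)}$. The surplus function is $E(u)=\mathbb{E}_\epsilon\left(\max_{1\le i\le n}\left(u^{(i)}+\epsilon^{(i)}\right)\right)$ for $u\in\mathbb{R}^n$. Its convex conjugate is $E^*(p)=\sup_{u\in\mathbb{R}^n}\left(\langle p,u\rangle-E(u)\right)$ for $p\in\mathbb{R}^n$. The simplex is $\Delta=\{p\in\mathbb{R}^n\mid \sum_{i=1}^n p^{(i)}=1,\ p^{(i)}\ge 0 \text{ for all } i\}$. Continuity on $\Delta$ means continuity of the restriction of $E^*$ to $\Delta$. *)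

theory Defs
  imports "HOL-Probability.Probability"
begin

definition measure_support :: "'a::topological_space measure \<Rightarrow> 'a set" where
  "measure_support N = {x. \<forall>U. open U \<longrightarrow> x \<in> U \<longrightarrow> emeasure N U > 0}"

definition surplus :: "'w measure \<Rightarrow> ('w \<Rightarrow> real ^ 'n::finite) \<Rightarrow> real ^ 'n \<Rightarrow> real" where
  "surplus M \<epsilon> u = (\<integral>\<omega>. (MAX i. u $ i + \<epsilon> \<omega> $ i) \<partial>M)"

text \<open>The supremum is over a nonempty set of real values, so the conjugate never takes the
  value \<open>-\<infinity>\<close>; its values lie in the reals extended by \<open>\<infinity>\<close> only.\<close>

definition convex_conjugate :: "('a::real_inner \<Rightarrow> real) \<Rightarrow> 'a \<Rightarrow> ereal" where
  "convex_conjugate f p = (SUP u. ereal (p \<bullet> u - f u))"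

definition effective_domain :: "('a \<Rightarrow> ereal) \<Rightarrow> 'a set" where
  "effective_domain f = {p. f p < \<infinity>}"

definition prob_simplex :: "(real ^ 'n::finite) set" where
  "prob_simplex = {p. (\<Sum>i\<in>UNIV. p $ i) = 1 \<and> (\<forall>i. p $ i \<ge> 0)}"

end

theory Submission
  imports Defs
begin

text \<open>
  Only two bounds on the surplus function \<open>E\<close> matter: with \<open>m\<close> the mean of \<open>\<epsilon>\<close> and \<open>C = E 0\<close>,
  one has \<open>u $ i + m $ i \<le> E u\<close> for every \<open>i\<close> (a maximum dominates each of its entries), and
  \<open>E u \<le> b + C\<close> whenever all \<open>u $ i \<le> b\<close>.

  Averaging the lower bound with the weights of a point \<open>p\<close> of the simplex gives
  \<open>\<langle>p, u\<rangle> - E u \<le> - \<langle>p, m\<rangle>\<close>, so the conjugate is finite there. Off the simplex, the upper bound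
  makes \<open>\<langle>p, u\<rangle> - E u\<close> unbounded, along the diagonal if the coordinates of \<open>p\<close> do not sum to 1,
  and along a negative coordinate axis if some coordinate of \<open>p\<close> is negative.

  As a supremum of affine functions the conjugate is lower semicontinuous. For the upper
  semicontinuity at \<open>q\<close>, let \<open>0 \<le> c < 1\<close>. The points \<open>p\<close> of the simplex that are close to
  \<open>q\<close> satisfy \<open>c * q $ i \<le> p $ i\<close> for all \<open>i\<close>: this is strict for \<open>p = q\<close> in the coordinates where
  \<open>q $ i > 0\<close>, and trivial in the others. Applying the lower bound on \<open>E\<close> with the nonnegative
  weights \<open>p - c *\<^sub>R q\<close> yields \<open>E\<^sup>* p \<le> c * E\<^sup>* q - \<langle>p - c *\<^sub>R q, m\<rangle>\<close>, and the right-hand side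
  tends to \<open>E\<^sup>* q\<close> as \<open>p\<close> tends to \<open>q\<close> and then \<open>c\<close> to 1. This is where the polyhedral shape of the
  simplex enters; a closed convex function need not be continuous on a general convex domain.
\<close>

section \<open>Bounds on the surplus function\<close>

lemma integrable_vec_nth:
  fixes f :: "'w \<Rightarrow> real ^ 'n::finite"
  assumes "integrable M f"
  shows "integrable M (\<lambda>\<omega>. f \<omega> $ i)"
  using integrable_bounded_linear[OF bounded_linear_vec_nth assms] .

lemma integrable_surplus:
  fixes \<epsilon> :: "'w \<Rightarrow> real ^ 'n::finite"
  assumes "prob_space M" "integrable M \<epsilon>"
  shows "integrable M (\<lambda>\<omega>. MAX i. u $ i + \<epsilon> \<omega> $ i)"
proof -
  interpret prob_space M by fact
  show ?thesis
    using integrable_vec_nth[OF assms(2)] by (intro integrable_MAX) auto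
qed

lemma surplus_ge:
  fixes \<epsilon> :: "'w \<Rightarrow> real ^ 'n::finite"
  assumes "prob_space M" "integrable M \<epsilon>"
  shows "u $ i + (\<integral>\<omega>. \<epsilon> \<omega> $ i \<partial>M) \<le> surplus M \<epsilon> u"
proof -
  interpret prob_space M by fact
  have "u $ i + (\<integral>\<omega>. \<epsilon> \<omega> $ i \<partial>M) = (\<integral>\<omega>. u $ i + \<epsilon> \<omega> $ i \<partial>M)"
    using integrable_vec_nth[OF assms(2)] by (simp add: prob_space)
  also have "\<dots> \<le> (\<integral>\<omega>. (MAX i. u $ i + \<epsilon> \<omega> $ i) \<partial>M)"
    using integrable_vec_nth[OF assms(2)]
    by (intro integral_mono integrable_surplus assms) auto
  finally show ?thesis
    by (simp add: surplus_def)
qed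

lemma surplus_le:
  fixes \<epsilon> :: "'w \<Rightarrow> real ^ 'n::finite"
  assumes "prob_space M" "integrable M \<epsilon>" and "\<And>i. u $ i \<le> b"
  shows "surplus M \<epsilon> u \<le> b + surplus M \<epsilon> 0"
proof -
  interpret prob_space M by fact
  have int: "integrable M (\<lambda>\<omega>. MAX i. \<epsilon> \<omega> $ i)"
    using integrable_surplus[OF assms(1,2), of 0] by simp
  have le: "(MAX i. u $ i + \<epsilon> \<omega> $ i) \<le> b + (MAX i. \<epsilon> \<omega> $ i)" for \<omega>
    by (auto intro!: add_mono assms(3))
  have "surplus M \<epsilon> u \<le> (\<integral>\<omega>. b + (MAX i. \<epsilon> \<omega> $ i) \<partial>M)"
    unfolding surplus_def using int le
    by (intro integral_mono integrable_surplus assms) auto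
  also have "\<dots> = b + surplus M \<epsilon> 0"
    using int by (simp add: surplus_def prob_space)
  finally show ?thesis .
qed

section \<open>The domain of the conjugate\<close>

lemma convex_conjugate_ge: "ereal (p \<bullet> u - f u) \<le> convex_conjugate f p"
  unfolding convex_conjugate_def by (rule SUP_upper) simp

lemma convex_conjugate_le_iff:
  "convex_conjugate f p \<le> ereal a \<longleftrightarrow> (\<forall>u. p \<bullet> u - f u \<le> a)"
  unfolding convex_conjugate_def by (simp add: SUP_le_iff)

text \<open>The lower bound averaged with nonnegative weights \<open>w\<close> of arbitrary total mass.\<close>

lemma weighted_lower_bound:
  fixes f :: "real ^ 'n::finite \<Rightarrow> real"
  assumes lower: "\<And>u i. u $ i + m $ i \<le> f u" and "\<And>i. 0 \<le> w $ i"
  shows "w \<bullet> u + w \<bullet> m \<le> (\<Sum>i\<in>UNIV. w $ i) * f u"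
proof -
  have "w \<bullet> u + w \<bullet> m = (\<Sum>i\<in>UNIV. w $ i * (u $ i + m $ i))"
    by (simp add: inner_vec_def sum.distrib algebra_simps)
  also have "\<dots> \<le> (\<Sum>i\<in>UNIV. w $ i * f u)"
    by (intro sum_mono mult_left_mono assms)
  finally show ?thesis
    by (simp add: sum_distrib_right)
qed

lemma convex_conjugate_le_on_simplex:
  fixes f :: "real ^ 'n::finite \<Rightarrow> real"
  assumes "\<And>u i. u $ i + m $ i \<le> f u" and "p \<in> prob_simplex"
  shows "convex_conjugate f p \<le> ereal (- (p \<bullet> m))"
  unfolding convex_conjugate_le_iff
proof
  fix u
  have "p \<bullet> u + p \<bullet> m \<le> (\<Sum>i\<in>UNIV. p $ i) * f u"
    using assms by (intro weighted_lower_bound) (auto simp: prob_simplex_def)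
  then show "p \<bullet> u - f u \<le> - (p \<bullet> m)"
    using assms(2) by (simp add: prob_simplex_def)
qed

text \<open>A line with positive slope exceeds every bound; the two cases off the simplex both use it.\<close>

lemma nonneg_line_bounded_imp_nonpos:
  fixes s a :: real
  assumes "\<And>t. 0 \<le> t \<Longrightarrow> t * s \<le> a"
  shows "s \<le> 0"
proof (rule ccontr)
  assume s: "\<not> s \<le> 0"
  have "(\<bar>a\<bar> + 1) / s * s \<le> a"
    using s by (intro assms) auto
  with s show False
    by simp
qed

lemma effective_domain_subset_simplex:
  fixes f :: "real ^ 'n::finite \<Rightarrow> real"
  assumes upper: "\<And>u b. (\<And>i. u $ i \<le> b) \<Longrightarrow> f u \<le> b + C"
  shows "effective_domain (convex_conjugate f) \<subseteq> prob_simplex"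
proof
  fix p assume p: "p \<in> effective_domain (convex_conjugate f)"
  obtain a where "convex_conjugate f p \<le> ereal a"
    using p less_ereal.simps unfolding effective_domain_def
    by (metis ereal_dense2 less_imp_le mem_Collect_eq)
  then have a: "p \<bullet> u \<le> a + f u" for u
    using convex_conjugate_le_iff[of f p a] by (auto simp: algebra_simps)
  have diagonal: "t * ((\<Sum>i\<in>UNIV. p $ i) - 1) \<le> a + C" for t
  proof -
    have "p \<bullet> vec t = t * (\<Sum>i\<in>UNIV. p $ i)"
      by (simp add: inner_vec_def sum_distrib_left mult.commute)
    with a[of "vec t"] upper[of "vec t" t] show ?thesis
      by (simp add: algebra_simps)
  qed
  have "(\<Sum>i\<in>UNIV. p $ i) - 1 \<le> 0"
    by (rule nonneg_line_bounded_imp_nonpos[OF diagonal])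
  moreover have "1 - (\<Sum>i\<in>UNIV. p $ i) \<le> 0"
  proof (rule nonneg_line_bounded_imp_nonpos)
    fix t :: real
    show "t * (1 - (\<Sum>i\<in>UNIV. p $ i)) \<le> a + C"
      using diagonal[of "- t"] by (simp add: algebra_simps)
  qed
  moreover have "0 \<le> p $ i" for i
  proof -
    have "- p $ i \<le> 0"
    proof (rule nonneg_line_bounded_imp_nonpos)
      fix t :: real assume "0 \<le> t"
      then have "f (axis i (- t)) \<le> 0 + C"
        by (intro upper) (simp add: axis_def)
      with a[of "axis i (- t)"] show "t * (- p $ i) \<le> a + C"
        by (simp add: inner_axis mult.commute)
    qed
    then show ?thesis by simp
  qed
  ultimately show "p \<in> prob_simplex"
    by (simp add: prob_simplex_def)
qed

section \<open>Continuity on the simplex\<close>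

text \<open>The conjugate at \<open>p\<close> is compared with its value at \<open>q\<close> by splitting off the share \<open>c\<close> of \<open>q\<close>
  contained in \<open>p\<close>; the remaining weights \<open>p - c *\<^sub>R q\<close> have total mass \<open>1 - c\<close>.\<close>

lemma convex_conjugate_le_scaled:
  fixes f :: "real ^ 'n::finite \<Rightarrow> real"
  assumes lower: "\<And>u i. u $ i + m $ i \<le> f u"
    and p: "p \<in> prob_simplex" and q: "q \<in> prob_simplex"
    and c: "0 \<le> c" "\<And>i. c * q $ i \<le> p $ i"
    and r: "convex_conjugate f q \<le> ereal r"
  shows "convex_conjugate f p \<le> ereal (c * r - (p - c *\<^sub>R q) \<bullet> m)"
  unfolding convex_conjugate_le_iff
proof
  fix u
  have "(\<Sum>i\<in>UNIV. (p - c *\<^sub>R q) $ i) = 1 - c"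
    using p q by (simp add: prob_simplex_def sum_subtractf flip: sum_distrib_left)
  with weighted_lower_bound[of m f "p - c *\<^sub>R q" u] lower c(2)
  have "(p - c *\<^sub>R q) \<bullet> u + (p - c *\<^sub>R q) \<bullet> m \<le> (1 - c) * f u"
    by simp
  moreover have "c * (q \<bullet> u - f u) \<le> c * r"
    using r c(1) by (intro mult_left_mono) (simp_all add: convex_conjugate_le_iff)
  ultimately show "p \<bullet> u - f u \<le> c * r - (p - c *\<^sub>R q) \<bullet> m"
    by (simp add: inner_diff_left algebra_simps)
qed

lemma continuous_on_convex_conjugate_simplex:
  fixes f :: "real ^ 'n::finite \<Rightarrow> real"
  assumes lower: "\<And>u i. u $ i + m $ i \<le> f u"
  shows "continuous_on prob_simplex (convex_conjugate f)"
  unfolding continuous_on_def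
proof (intro ballI order_tendstoI)
  fix q :: "real ^ 'n" and a :: ereal
  assume "a < convex_conjugate f q"
  then obtain u where u: "a < ereal (q \<bullet> u - f u)"
    unfolding convex_conjugate_def less_SUP_iff by auto
  have "((\<lambda>p. ereal (p \<bullet> u - f u)) \<longlongrightarrow> ereal (q \<bullet> u - f u)) (at q within prob_simplex)"
    by (intro tendsto_intros)
  from order_tendstoD(1)[OF this u]
  show "\<forall>\<^sub>F p in at q within prob_simplex. a < convex_conjugate f p"
    by eventually_elim (use convex_conjugate_ge less_le_trans in blast)
next
  fix q :: "real ^ 'n" and a :: ereal
  assume q: "q \<in> prob_simplex" and a: "convex_conjugate f q < a"
  have "convex_conjugate f q \<le> ereal (- (q \<bullet> m))"
    by (rule convex_conjugate_le_on_simplex[OF lower q])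
  moreover have "ereal (q \<bullet> 0 - f 0) \<le> convex_conjugate f q"
    by (rule convex_conjugate_ge)
  ultimately obtain r where r: "convex_conjugate f q = ereal r"
    by (cases "convex_conjugate f q") auto
  have "((\<lambda>c. c * r - (q - c *\<^sub>R q) \<bullet> m) \<longlongrightarrow> 1 * r - (q - 1 *\<^sub>R q) \<bullet> m) (at_left 1)"
    by (intro tendsto_intros)
  then have "((\<lambda>c. ereal (c * r - (q - c *\<^sub>R q) \<bullet> m)) \<longlongrightarrow> ereal r) (at_left 1)"
    by simp
  then have "\<forall>\<^sub>F c in at_left 1. ereal (c * r - (q - c *\<^sub>R q) \<bullet> m) < a"
    using a unfolding r by (rule order_tendstoD(2))
  moreover have "\<forall>\<^sub>F c in at_left (1::real). 0 < c \<and> c < 1"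
    unfolding eventually_at_left_field by (intro exI[of _ 0]) auto
  ultimately have "\<forall>\<^sub>F c in at_left 1. ereal (c * r - (q - c *\<^sub>R q) \<bullet> m) < a \<and> 0 < c \<and> c < 1"
    by eventually_elim simp
  then obtain c where c: "ereal (c * r - (q - c *\<^sub>R q) \<bullet> m) < a" "0 < c" "c < 1"
    using eventually_happens[of _ "at_left (1::real)"] by auto
  have "((\<lambda>p. ereal (c * r - (p - c *\<^sub>R q) \<bullet> m)) \<longlongrightarrow> ereal (c * r - (q - c *\<^sub>R q) \<bullet> m))
      (at q within prob_simplex)"
    by (intro tendsto_intros)
  then have close: "\<forall>\<^sub>F p in at q within prob_simplex. ereal (c * r - (p - c *\<^sub>R q) \<bullet> m) < a"
    using c(1) by (rule order_tendstoD(2))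
  have inside: "\<forall>\<^sub>F p in at q within prob_simplex. p \<in> prob_simplex"
    by (simp add: eventually_at_filter)
  have "\<forall>\<^sub>F p in at q within prob_simplex. c * q $ i \<le> p $ i" for i
  proof (cases "q $ i = 0")
    case True
    show ?thesis
      using inside by eventually_elim (simp add: True prob_simplex_def)
  next
    case False
    then have "c * q $ i < q $ i"
      using c(3) q by (auto simp: prob_simplex_def less_le)
    moreover have "((\<lambda>p. p $ i) \<longlongrightarrow> q $ i) (at q within prob_simplex)"
      by (intro tendsto_intros)
    ultimately have "\<forall>\<^sub>F p in at q within prob_simplex. c * q $ i < p $ i"
      by (simp add: order_tendstoD(1))
    then show ?thesis
      by eventually_elim simp
  qed
  then have "\<forall>\<^sub>F p in at q within prob_simplex. \<forall>i. c * q $ i \<le> p $ i"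
    by (simp add: eventually_all_finite)
  with close inside show "\<forall>\<^sub>F p in at q within prob_simplex. convex_conjugate f p < a"
  proof eventually_elim
    case (elim p)
    have "convex_conjugate f p \<le> ereal (c * r - (p - c *\<^sub>R q) \<bullet> m)"
      using elim c(2) q r by (intro convex_conjugate_le_scaled lower) auto
    with elim show ?case by simp
  qed
qed

theorem theorem1:
  fixes M :: "'w measure" and \<epsilon> :: "'w \<Rightarrow> real ^ 'n::finite"
  assumes "prob_space M"
    and "\<epsilon> \<in> borel_measurable M"
    and "integrable M \<epsilon>"
    and "absolutely_continuous lborel (distr M borel \<epsilon>)"
    and "measure_support (distr M borel \<epsilon>) = UNIV"
  shows "effective_domain (convex_conjugate (surplus M \<epsilon>)) = (prob_simplex :: (real ^ 'n) set)
    \<and> continuous_on (prob_simplex :: (real ^ 'n) set) (convex_conjugate (surplus M \<epsilon>))"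
proof -
  define m :: "real ^ 'n" where "m = (\<chi> i. \<integral>\<omega>. \<epsilon> \<omega> $ i \<partial>M)"
  have lower: "u $ i + m $ i \<le> surplus M \<epsilon> u" for u i
    using surplus_ge[OF assms(1,3)] by (simp add: m_def)
  have "effective_domain (convex_conjugate (surplus M \<epsilon>)) \<subseteq> prob_simplex"
    by (rule effective_domain_subset_simplex) (rule surplus_le[OF assms(1,3)])
  moreover have "prob_simplex \<subseteq> effective_domain (convex_conjugate (surplus M \<epsilon>))"
    unfolding effective_domain_def
    by (auto intro!: le_less_trans[OF convex_conjugate_le_on_simplex[OF lower]]
        simp del: ereal_infty_less)
  ultimately show ?thesis
    using continuous_on_convex_conjugate_simplex[OF lower] by blast
qed

end
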